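(* Consider the Fulfillment Optimization (FO) problem with $I$ products, $J$ nodes, horizon $T$, initial state $s_1=(x_1,c_1)\in\mathbb R^{IJ}\times\mathbb R^J$ and disturbance sequence $(\omega_t)_{t\in[T]}$. Let $\pi$ be a fulfillment policy satisfying Inventory Independence, Consistency and Monotonicity. Run the Picard iteration with time-steps assigned to processes by product, i.e. for some partition $I_1,\dots,I_M$ of $[I]$ into disjoint sets, process $m$ is assigned $\mathcal T_m=\{t\in[T]: i(\omega_t)\in I_m\}$. Let $\mathcal Q_T\subseteq[J]$ be the set of nodes that run out of capacity at some time $t\le T$ under sequential simulation of $\pi$. Then the Picard iteration converges in at most $|\mathcal Q_T|+1$ iterations, i.e. $\alpha^k_t=a^{\mathrm{seq}}_t$ for all $t\in[T]$ and all $k\ge|\mathcal Q_T|+1$, where $\alpha^k$ is the action cache after $k$ iterations and $a^{\mathrm{seq}}$ is the sequence of actions under sequential simulation.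
   Context: Notation: $[n]=\{1,\dots,n\}$; $e_j\in\mathbb R^J$ and $e_{i,j}\in\mathbb R^{IJ}$ are unit vectors, with the convention $e_0=0$, $e_{i,0}=0$. FO problem: A state is $s=(x,c)$, where $x_{i,j}$ is the inventory of product $i\in[I]$ at node $j\in[J]$ and $c_j$ is the remaining capacity of node $j$. A disturbance (order) $\omega\in\Omega$ has an associated product $i(\omega)\in[I]$ (and a reward vector $r(\omega)\in\mathbb R^J$). The actions are $[J]\cup\{0\}$, with $0$ meaning "do not fulfill"; given $\omega$, the feasible actions in state $(x,c)$ are $\mathcal A_\omega(x,c)=\{j\in[J]: c_j>0,\ x_{i(\omega),j}>0\}\cup\{0\}$. The transition is $f((x,c),a,\omega)=(x-e_{i(\omega),a},\,c-e_a)$. A policy is a map $\pi$ with $\pi((x,c),\omega)\in\mathcal A_\omega(x,c)$ for all $(x,c)\in\mathbb R^{IJ}\times\mathbb R^J$, $\omega\in\Omega$. Sequential simulation: $s_1^{\mathrm{seq}}=s_1$, $a_t^{\mathrm{seq}}=\pi(s_t^{\mathrm{seq}},\omega_t)$, $s^{\mathrm{seq}}_{t+1}=f(s^{\mathrm{seq}}_t,a^{\mathrm{seq}}_t,\omega_t)$; write $s_t^{\mathrm{seq}}=(x_t^{\mathrm{seq}},c_t^{\mathrm{seq}})$. Let $\tau_j=\min\{t\in[T]: c^{\mathrm{seq}}_{t,j}\le 0\}$ (and $\tau_j=T+1$ if there is no such $t$) and $\mathcal Q_t=\{j\in[J]:\tau_j\le t\}$. Assumptions on $\pi$: (1) Inventory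 Independence: for $i\in[I]$ and $x,x'\in\mathbb R^{IJ}$ with $x_{i,j}=x'_{i,j}$ for all $j$, if $i(\omega)=i$ then $\pi((x,c),\omega)=\pi((x',c),\omega)$ for all $c$. (2) Consistency: suppose $\pi((x,c),\omega)=j$ (with $j\in[J]\cup\{0\}$) and $i(\omega)=i$. If, for some $j'\in[J]$, $x'$ agrees with $x$ except possibly in component $(i,j')$ and $c'$ agrees with $c$ except possibly in component $j'$, then $\pi((x',c'),\omega)\in\{j,j'\}$. (3) Monotonicity: suppose $\pi((x,c),\omega)=j$ and $i(\omega)=i$. Then $\pi((x+e_{i,j},c),\omega)=j$; and for any $j'\in[J]$ with $c_{j'}>0$, $\pi((x,c+e_{j'}),\omega)=j$. Picard iteration: Initialize the cache $\alpha^0_t=0$ for all $t\in[T]$. For $k=1,2,\dots$: each process $m\in[M]$ sets $s^{k,m}_1=s_1$ and, for $t=1,\dots,T$ in order, sets $a^{k,m}_t=\pi(s^{k,m}_t,\omega_t)$ if $t\in\mathcal T_m$; if $t\notin\mathcal T_m$, it sets $a^{k,m}_t=\alpha^{k-1}_t$ if $\alpha^{k-1}_t\in\mathcal A_{\omega_t}(s^{k,m}_t)$ and $a^{k,m}_t=0$ otherwise; then $s^{k,m}_{t+1}=f(s^{k,m}_t,a^{k,m}_t,\omega_t)$. After all processes finish, $\alpha^k_t=a^{k,m}_t$ for the unique $m$ with $t\in\mathcal T_m$. The algorithm stops when $\alpha^k=\alpha^{k-1}$; the sequences $\alpha^k$ are regarded as defined for all $k\ge0$ by the same recursion. "Converges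 in at most $N$ iterations" means $\alpha^k_t=a_t^{\mathrm{seq}}$ for all $t\in[T]$ and all $k\ge N$ (not counting a possible extra iteration for the stopping test). *)

theory Defs
  imports "HOL-Analysis.Analysis"
begin

text \<open>
  Products are the elements of a finite type \<open>'i\<close>, nodes those of a finite type \<open>'j\<close>, and
  orders those of an arbitrary type \<open>'w\<close>; \<open>p w\<close> is the product of order \<open>w\<close>.
  The reward of an order plays no role in the dynamics; since \<open>'w\<close> is arbitrary,
  an order may carry one and the policy may depend on it.
  An action is a \<open>'j option\<close>: \<open>None\<close> is the action \<open>0\<close> (do not fulfill).
\<close>

type_synonym ('i, 'j) fo_state = "(real ^ 'j ^ 'i) \<times> (real ^ 'j)"
type_synonym ('i, 'j, 'w) fo_policy = "('i, 'j) fo_state \<Rightarrow> 'w \<Rightarrow> 'j option"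

definition cap_unit :: "'j option \<Rightarrow> real ^ 'j::finite" where
  "cap_unit a = (case a of None \<Rightarrow> 0 | Some j \<Rightarrow> axis j 1)"

definition inv_unit :: "'i \<Rightarrow> 'j option \<Rightarrow> real ^ 'j::finite ^ 'i::finite" where
  "inv_unit i a = (case a of None \<Rightarrow> 0 | Some j \<Rightarrow> axis i (axis j 1))"

definition feasible :: "('w \<Rightarrow> 'i) \<Rightarrow> 'w \<Rightarrow> ('i::finite, 'j::finite) fo_state \<Rightarrow> 'j option set" where
  "feasible p w s = {Some j | j. snd s $ j > 0 \<and> fst s $ p w $ j > 0} \<union> {None}"

definition transition ::
  "('w \<Rightarrow> 'i) \<Rightarrow> ('i::finite, 'j::finite) fo_state \<Rightarrow> 'j option \<Rightarrow> 'w \<Rightarrow> ('i, 'j) fo_state" where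
  "transition p s a w = (fst s - inv_unit (p w) a, snd s - cap_unit a)"

definition fulfillment_policy ::
  "('w \<Rightarrow> 'i) \<Rightarrow> ('i::finite, 'j::finite, 'w) fo_policy \<Rightarrow> bool" where
  "fulfillment_policy p \<pi> \<longleftrightarrow> (\<forall>x c w. \<pi> (x, c) w \<in> feasible p w (x, c))"

definition inventory_independence ::
  "('w \<Rightarrow> 'i) \<Rightarrow> ('i::finite, 'j::finite, 'w) fo_policy \<Rightarrow> bool" where
  "inventory_independence p \<pi> \<longleftrightarrow>
     (\<forall>i x x' w. (\<forall>j. x $ i $ j = x' $ i $ j) \<longrightarrow> p w = i \<longrightarrow>
        (\<forall>c. \<pi> (x, c) w = \<pi> (x', c) w))"

text \<open>
  The perturbed node \<open>j'\<close> is taken to differ from the chosen action \<open>a\<close>. Without this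
  restriction, \<open>a = Some j'\<close> would force the policy to keep choosing \<open>j'\<close> even after all stock
  of \<open>j'\<close> is removed, so that only the policy that never fulfills would remain
  (lemma \<open>unrestricted_consistency_trivial\<close> below). The restriction only weakens the assumption.
\<close>

definition consistency ::
  "('w \<Rightarrow> 'i) \<Rightarrow> ('i::finite, 'j::finite, 'w) fo_policy \<Rightarrow> bool" where
  "consistency p \<pi> \<longleftrightarrow>
     (\<forall>x c w a i. \<pi> (x, c) w = a \<longrightarrow> p w = i \<longrightarrow>
        (\<forall>j' x' c'. Some j' \<noteq> a \<longrightarrow>
           (\<forall>l n. (l, n) \<noteq> (i, j') \<longrightarrow> x' $ l $ n = x $ l $ n) \<longrightarrow>
           (\<forall>n. n \<noteq> j' \<longrightarrow> c' $ n = c $ n) \<longrightarrow>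
           \<pi> (x', c') w \<in> {a, Some j'}))"

lemma unrestricted_consistency_trivial:
  fixes \<pi> :: "('i::finite, 'j::finite, 'w) fo_policy"
  assumes pol: "fulfillment_policy p \<pi>"
    and unrestricted: "\<And>x c w a i j' x' c'. \<pi> (x, c) w = a \<Longrightarrow> p w = i \<Longrightarrow>
      (\<forall>l n. (l, n) \<noteq> (i, j') \<longrightarrow> x' $ l $ n = x $ l $ n) \<Longrightarrow>
      (\<forall>n. n \<noteq> j' \<longrightarrow> c' $ n = c $ n) \<Longrightarrow> \<pi> (x', c') w \<in> {a, Some j'}"
  shows "\<pi> (x, c) w = None"
proof (rule ccontr)
  assume "\<pi> (x, c) w \<noteq> None"
  then obtain j where j: "\<pi> (x, c) w = Some j" by auto
  define c' where "c' = (\<chi> n. if n = j then 0 else c $ n)"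
  have "\<pi> (x, c') w \<in> {Some j, Some j}"
    by (rule unrestricted[OF j refl]) (auto simp: c'_def)
  moreover have "\<pi> (x, c') w \<in> feasible p w (x, c')"
    using pol by (simp add: fulfillment_policy_def)
  ultimately show False by (simp add: feasible_def c'_def)
qed

definition monotonicity ::
  "('w \<Rightarrow> 'i) \<Rightarrow> ('i::finite, 'j::finite, 'w) fo_policy \<Rightarrow> bool" where
  "monotonicity p \<pi> \<longleftrightarrow>
     (\<forall>x c w a i. \<pi> (x, c) w = a \<longrightarrow> p w = i \<longrightarrow>
        \<pi> (x + inv_unit i a, c) w = a \<and>
        (\<forall>j'. c $ j' > 0 \<longrightarrow> \<pi> (x, c + cap_unit (Some j')) w = a))"

text \<open>
  Time-steps are \<open>1, \<dots>, T\<close>, and \<open>\<omega> t\<close> is the order at time \<open>t\<close>. In both simulations below,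
  the state at index \<open>0\<close> is a dummy and the state at index \<open>1\<close> is the initial state.
\<close>

primrec seq_state ::
  "('w \<Rightarrow> 'i) \<Rightarrow> ('i::finite, 'j::finite, 'w) fo_policy \<Rightarrow> ('i, 'j) fo_state \<Rightarrow> (nat \<Rightarrow> 'w) \<Rightarrow>
   nat \<Rightarrow> ('i, 'j) fo_state" where
  "seq_state p \<pi> s1 \<omega> 0 = s1"
| "seq_state p \<pi> s1 \<omega> (Suc t) =
     (if t = 0 then s1
      else transition p (seq_state p \<pi> s1 \<omega> t) (\<pi> (seq_state p \<pi> s1 \<omega> t) (\<omega> t)) (\<omega> t))"

definition seq_action ::
  "('w \<Rightarrow> 'i) \<Rightarrow> ('i::finite, 'j::finite, 'w) fo_policy \<Rightarrow> ('i, 'j) fo_state \<Rightarrow> (nat \<Rightarrow> 'w) \<Rightarrow>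
   nat \<Rightarrow> 'j option" where
  "seq_action p \<pi> s1 \<omega> t = \<pi> (seq_state p \<pi> s1 \<omega> t) (\<omega> t)"

definition exhaustion_time ::
  "('w \<Rightarrow> 'i) \<Rightarrow> ('i::finite, 'j::finite, 'w) fo_policy \<Rightarrow> ('i, 'j) fo_state \<Rightarrow> (nat \<Rightarrow> 'w) \<Rightarrow>
   nat \<Rightarrow> 'j \<Rightarrow> nat" where
  "exhaustion_time p \<pi> s1 \<omega> T j =
     (if \<exists>t\<in>{1..T}. snd (seq_state p \<pi> s1 \<omega> t) $ j \<le> 0
      then Min {t \<in> {1..T}. snd (seq_state p \<pi> s1 \<omega> t) $ j \<le> 0}
      else T + 1)"

definition exhausted_nodes ::
  "('w \<Rightarrow> 'i) \<Rightarrow> ('i::finite, 'j::finite, 'w) fo_policy \<Rightarrow> ('i, 'j) fo_state \<Rightarrow> (nat \<Rightarrow> 'w) \<Rightarrow>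
   nat \<Rightarrow> nat \<Rightarrow> 'j set" where
  "exhausted_nodes p \<pi> s1 \<omega> T t = {j. exhaustion_time p \<pi> s1 \<omega> T j \<le> t}"

definition assigned_times :: "('w \<Rightarrow> 'i) \<Rightarrow> (nat \<Rightarrow> 'w) \<Rightarrow> nat \<Rightarrow> 'i set \<Rightarrow> nat set" where
  "assigned_times p \<omega> T P = {t \<in> {1..T}. p (\<omega> t) \<in> P}"

text \<open>
  One process with assigned times \<open>A\<close>, reading the cache \<open>\<alpha>\<close> of the previous iteration:
  its action at time \<open>t\<close> in state \<open>s\<close>, and its state trajectory.
\<close>

definition process_action ::
  "('w \<Rightarrow> 'i) \<Rightarrow> ('i::finite, 'j::finite, 'w) fo_policy \<Rightarrow> (nat \<Rightarrow> 'w) \<Rightarrow> nat set \<Rightarrow>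
   (nat \<Rightarrow> 'j option) \<Rightarrow> ('i, 'j) fo_state \<Rightarrow> nat \<Rightarrow> 'j option" where
  "process_action p \<pi> \<omega> A \<alpha> s t =
     (if t \<in> A then \<pi> s (\<omega> t)
      else if \<alpha> t \<in> feasible p (\<omega> t) s then \<alpha> t
      else None)"

primrec process_state ::
  "('w \<Rightarrow> 'i) \<Rightarrow> ('i::finite, 'j::finite, 'w) fo_policy \<Rightarrow> ('i, 'j) fo_state \<Rightarrow> (nat \<Rightarrow> 'w) \<Rightarrow>
   nat set \<Rightarrow> (nat \<Rightarrow> 'j option) \<Rightarrow> nat \<Rightarrow> ('i, 'j) fo_state" where
  "process_state p \<pi> s1 \<omega> A \<alpha> 0 = s1"
| "process_state p \<pi> s1 \<omega> A \<alpha> (Suc t) =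
     (if t = 0 then s1
      else transition p (process_state p \<pi> s1 \<omega> A \<alpha> t)
             (process_action p \<pi> \<omega> A \<alpha> (process_state p \<pi> s1 \<omega> A \<alpha> t) t) (\<omega> t))"

text \<open>
  \<open>picard_cache p \<pi> s1 \<omega> T M P k t\<close> is the cached action for time \<open>t\<close> after \<open>k\<close> iterations, with
  processes \<open>1, \<dots>, M\<close> and \<open>P m\<close> the set of products of process \<open>m\<close>. Only its values at
  \<open>t \<in> {1..T}\<close> are meaningful.
\<close>

primrec picard_cache ::
  "('w \<Rightarrow> 'i) \<Rightarrow> ('i::finite, 'j::finite, 'w) fo_policy \<Rightarrow> ('i, 'j) fo_state \<Rightarrow> (nat \<Rightarrow> 'w) \<Rightarrow>
   nat \<Rightarrow> nat \<Rightarrow> (nat \<Rightarrow> 'i set) \<Rightarrow> nat \<Rightarrow> nat \<Rightarrow> 'j option" where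
  "picard_cache p \<pi> s1 \<omega> T M P 0 = (\<lambda>t. None)"
| "picard_cache p \<pi> s1 \<omega> T M P (Suc k) =
     (\<lambda>t. let m = (THE m. m \<in> {1..M} \<and> t \<in> assigned_times p \<omega> T (P m));
              A = assigned_times p \<omega> T (P m);
              \<alpha> = picard_cache p \<pi> s1 \<omega> T M P k
          in process_action p \<pi> \<omega> A \<alpha> (process_state p \<pi> s1 \<omega> A \<alpha> t) t)"

end

theory Submission
  imports Defs
begin

text \<open>
  By Consistency and Monotonicity, a process deviates from the sequential action only towards a
  node that is exhausted sequentially or whose stock of the ordered product differs from the
  sequential one. It follows by induction that, at every node that still has capacity
  sequentially, each product has been served at most as often in the cache as in sequential
  simulation. Every process therefore sees these nodes with the sequential capacity plus a
  natural number, which by Monotonicity does not affect the policy. A first error can then only concern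
  an exhausted node, and not even there if the cache was correct up to its exhaustion; so
  each iteration corrects the cache up to the next exhaustion time.
\<close>

section \<open>Usage counts and the states they determine\<close>

definition usage :: "('w \<Rightarrow> 'i) \<Rightarrow> (nat \<Rightarrow> 'w) \<Rightarrow> (nat \<Rightarrow> 'j option) \<Rightarrow> 'i \<Rightarrow> 'j \<Rightarrow> nat \<Rightarrow> nat" where
  "usage p \<omega> a i j t = card {s \<in> {1..<t}. p (\<omega> s) = i \<and> a s = Some j}"

lemma usage_1 [simp]: "usage p \<omega> a i j (Suc 0) = 0"
  by (simp add: usage_def)

lemma usage_Suc:
  assumes "t \<ge> 1"
  shows "usage p \<omega> a i j (Suc t) =
    usage p \<omega> a i j t + (if p (\<omega> t) = i \<and> a t = Some j then 1 else 0)"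
proof (cases "p (\<omega> t) = i \<and> a t = Some j")
  case True
  then have "{s \<in> {1..<Suc t}. p (\<omega> s) = i \<and> a s = Some j} =
      insert t {s \<in> {1..<t}. p (\<omega> s) = i \<and> a s = Some j}"
    using assms by (auto simp: less_Suc_eq)
  then show ?thesis using True by (simp add: usage_def)
next
  case False
  then have "{s \<in> {1..<Suc t}. p (\<omega> s) = i \<and> a s = Some j} =
      {s \<in> {1..<t}. p (\<omega> s) = i \<and> a s = Some j}"
    by (auto simp: less_Suc_eq)
  then show ?thesis using False by (simp add: usage_def)
qed

lemma usage_mono:
  assumes "\<And>s. s \<in> {1..<t} \<Longrightarrow> p (\<omega> s) = i \<Longrightarrow> a s = Some j \<Longrightarrow> b s = Some j"
  shows "usage p \<omega> a i j t \<le> usage p \<omega> b i j t"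
  unfolding usage_def by (rule card_mono) (use assms in auto)

lemma usage_cong:
  assumes "\<And>s. s \<in> {1..<t} \<Longrightarrow> p (\<omega> s) = i \<Longrightarrow> a s = b s"
  shows "usage p \<omega> a i j t = usage p \<omega> b i j t"
  by (intro antisym usage_mono) (use assms in auto)

text \<open>Stated for an arbitrary trajectory so that it serves sequential simulation and every
  process alike. \<open>usage\<close> counts strictly before \<open>t\<close> because the state at
  \<open>t\<close> precedes the action at \<open>t\<close>.\<close>

lemma inventory_usage:
  fixes S :: "nat \<Rightarrow> ('i::finite, 'j::finite) fo_state"
  assumes steps: "\<forall>t\<ge>1. S (Suc t) = transition p (S t) (a t) (\<omega> t)"
    and "t \<ge> 1"
  shows "fst (S t) $ i $ j = fst (S 1) $ i $ j - real (usage p \<omega> a i j t)"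
  using \<open>t \<ge> 1\<close>
proof (induction t rule: dec_induct)
  case (step t)
  then show ?case
    by (simp add: steps usage_Suc transition_def inv_unit_def axis_def split: option.split)
qed simp

lemma capacity_usage:
  fixes S :: "nat \<Rightarrow> ('i::finite, 'j::finite) fo_state"
  assumes steps: "\<forall>t\<ge>1. S (Suc t) = transition p (S t) (a t) (\<omega> t)"
    and "t \<ge> 1"
  shows "snd (S t) $ j = snd (S 1) $ j - (\<Sum>i\<in>UNIV. real (usage p \<omega> a i j t))"
  using \<open>t \<ge> 1\<close>
proof (induction t rule: dec_induct)
  case (step t)
  \<comment> \<open>Only the product ordered at \<open>t\<close> can gain, so the added indicators
    collapse to a single one.\<close>
  have "(\<Sum>i\<in>UNIV. real (usage p \<omega> a i j (Suc t))) =
      (\<Sum>i\<in>UNIV. real (usage p \<omega> a i j t) + (if p (\<omega> t) = i then of_bool (a t = Some j) else 0))"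
    using step by (intro sum.cong) (auto simp: usage_Suc)
  then have "(\<Sum>i\<in>UNIV. real (usage p \<omega> a i j (Suc t))) =
      (\<Sum>i\<in>UNIV. real (usage p \<omega> a i j t)) + of_bool (a t = Some j)"
    by (simp add: sum.distrib)
  with step show ?case
    by (simp add: steps transition_def cap_unit_def axis_def split: option.split)
qed simp

lemma capacity_antimono:
  fixes S :: "nat \<Rightarrow> ('i::finite, 'j::finite) fo_state"
  assumes steps: "\<forall>t\<ge>1. S (Suc t) = transition p (S t) (a t) (\<omega> t)"
    and "1 \<le> s" "s \<le> t"
  shows "snd (S t) $ j \<le> snd (S s) $ j"
proof -
  have "usage p \<omega> a i j s \<le> usage p \<omega> a i j t" for i
    unfolding usage_def by (rule card_mono) (use \<open>s \<le> t\<close> in auto)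
  then show ?thesis
    using capacity_usage[OF steps, of s j] capacity_usage[OF steps, of t j] assms(2,3)
    by (simp add: sum_mono)
qed

section \<open>Policies under changes at several nodes\<close>

locale picard_fo =
  fixes p :: "'w \<Rightarrow> 'i::finite"
    and \<pi> :: "('i, 'j::finite, 'w) fo_policy"
    and s1 :: "('i, 'j) fo_state"
    and \<omega> :: "nat \<Rightarrow> 'w"
    and T M :: nat
    and P :: "nat \<Rightarrow> 'i set"
  assumes policy: "fulfillment_policy p \<pi>"
    and independence: "inventory_independence p \<pi>"
    and consistent: "consistency p \<pi>"
    and monotone: "monotonicity p \<pi>"
    and disjoint: "disjoint_family_on P {1..M}"
    and cover: "(\<Union>m\<in>{1..M}. P m) = UNIV"
begin

lemma policy_feasible:
  assumes "\<pi> (x, c) w = Some j"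
  shows "c $ j > 0"
proof -
  have "\<pi> (x, c) w \<in> feasible p w (x, c)"
    using policy by (simp add: fulfillment_policy_def)
  then show ?thesis by (simp add: assms feasible_def)
qed

lemma raise_capacity:
  assumes "c $ j > 0"
  shows "\<pi> (x, c + real n *\<^sub>R axis j 1) w = \<pi> (x, c) w"
proof (induction n)
  case (Suc n)
  \<comment> \<open>Raising keeps the capacity positive, so the side condition of Monotonicity holds
    for every unit added.\<close>
  have "(c + real n *\<^sub>R axis j 1) $ j > 0" using assms by (simp add: axis_def add_pos_nonneg)
  then have "\<pi> (x, (c + real n *\<^sub>R axis j 1) + cap_unit (Some j)) w =
      \<pi> (x, c + real n *\<^sub>R axis j 1) w"
    using monotone unfolding monotonicity_def by blast
  with Suc show ?case by (simp add: cap_unit_def algebra_simps)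
qed simp

text \<open>The nodes are raised one at a time: \<open>d\<close> keeps the old capacity at the newly
  inserted node, so the induction hypothesis covers the others and \<open>raise_capacity\<close>
  makes the last raise.\<close>

lemma raise_capacities:
  assumes "finite N"
    and "\<And>j. j \<notin> N \<Longrightarrow> c' $ j = c $ j"
    and "\<And>j. j \<in> N \<Longrightarrow> c $ j > 0 \<and> (\<exists>n. c' $ j = c $ j + real n)"
  shows "\<pi> (x, c') w = \<pi> (x, c) w"
  using assms
proof (induction N arbitrary: c' rule: finite_induct)
  case empty
  then have "c' = c" by (simp add: vec_eq_iff)
  then show ?case by simp
next
  case (insert j N)
  define d where "d = (\<chi> l. if l = j then c $ j else c' $ l)"
  have "\<pi> (x, d) w = \<pi> (x, c) w"
    by (rule insert.IH) (use insert in \<open>auto simp: d_def\<close>)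
  moreover obtain n where "c' $ j = c $ j + real n" and pos: "c $ j > 0"
    using insert.prems(2)[of j] by auto
  then have "c' = d + real n *\<^sub>R axis j 1"
    by (simp add: vec_eq_iff d_def axis_def)
  moreover have "d $ j > 0" using pos by (simp add: d_def)
  ultimately show ?case by (simp add: raise_capacity)
qed

lemma raise_chosen_inventory:
  assumes "\<pi> (x, c) w = a"
  shows "\<pi> (x + real n *\<^sub>R inv_unit (p w) a, c) w = a"
proof (induction n)
  case (Suc n)
  then have "\<pi> ((x + real n *\<^sub>R inv_unit (p w) a) + inv_unit (p w) a, c) w = a"
    using monotone unfolding monotonicity_def by blast
  then show ?case by (simp add: algebra_simps)
qed (use assms in simp)

text \<open>Consistency is applied to one node at a time. The intermediate decision is the original
  one or a node already changed, hence never the node about to change, as the restricted form of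
  Consistency demands. Stocks of other products may differ arbitrarily; Inventory Independence
  absorbs this in the empty case.\<close>

lemma consistency_finite:
  assumes "finite N"
    and "\<pi> (x, c) w \<notin> Some ` N"
    and "\<And>j. j \<notin> N \<Longrightarrow> x' $ p w $ j = x $ p w $ j \<and> c' $ j = c $ j"
  shows "\<pi> (x', c') w \<in> insert (\<pi> (x, c) w) (Some ` N)"
  using assms
proof (induction N arbitrary: x' c' rule: finite_induct)
  case empty
  then have "c' = c" by (simp add: vec_eq_iff)
  moreover have "\<forall>j. x' $ p w $ j = x $ p w $ j" using empty by simp
  ultimately show ?case using independence unfolding inventory_independence_def by blast
next
  case (insert j N)
  define d where "d = (\<chi> l. if l = j then c $ j else c' $ l)"
  define y where "y = (\<chi> i l. if i = p w \<and> l = j then x $ i $ l else x' $ i $ l)"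
  have IH: "\<pi> (y, d) w \<in> insert (\<pi> (x, c) w) (Some ` N)"
    by (rule insert.IH) (use insert in \<open>auto simp: d_def y_def\<close>)
  then have "Some j \<noteq> \<pi> (y, d) w" using insert by auto
  moreover have "\<forall>l n. (l, n) \<noteq> (p w, j) \<longrightarrow> x' $ l $ n = y $ l $ n"
    and "\<forall>n. n \<noteq> j \<longrightarrow> c' $ n = d $ n"
    by (auto simp: y_def d_def)
  ultimately have "\<pi> (x', c') w \<in> {\<pi> (y, d) w, Some j}"
    using consistent unfolding consistency_def by blast
  with IH show ?case by auto
qed

text \<open>The change is made in three stages: adjust capacities where they are positive
  (\<open>d\<close>), raise the stock at the chosen node (\<open>y\<close>), then change the rest.
  Monotonicity preserves the action in the first two stages; in the last, Consistency lets it move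
  only to a node of \<open>?N\<close>.\<close>

lemma policy_shift:
  assumes cap: "\<And>j. c $ j > 0 \<Longrightarrow> \<exists>n. c' $ j = c $ j + real n"
    and inv: "\<And>j. \<pi> (x, c) w = Some j \<Longrightarrow> \<exists>n. x' $ p w $ j = x $ p w $ j + real n"
    and new: "\<pi> (x', c') w \<noteq> \<pi> (x, c) w"
  shows "\<exists>j. \<pi> (x', c') w = Some j \<and> (c $ j \<le> 0 \<or> x' $ p w $ j \<noteq> x $ p w $ j)"
proof -
  define a where "a = \<pi> (x, c) w"
  define d where "d = (\<chi> j. if c $ j > 0 then c' $ j else c $ j)"
  have d: "\<pi> (x, d) w = a"
    unfolding a_def by (rule raise_capacities[of "{j. c $ j > 0}"]) (use cap in \<open>auto simp: d_def\<close>)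
  obtain y where y: "\<pi> (y, d) w = a"
    and y_chosen: "\<And>j. a = Some j \<Longrightarrow> y $ p w $ j = x' $ p w $ j"
    and y_other: "\<And>j. a \<noteq> Some j \<Longrightarrow> y $ p w $ j = x $ p w $ j"
  proof (cases a)
    case None
    then show ?thesis using that[of x] d by simp
  next
    case (Some b)
    then obtain n where "x' $ p w $ b = x $ p w $ b + real n" using inv by (auto simp: a_def)
    with Some show ?thesis
      using that[of "x + real n *\<^sub>R inv_unit (p w) a"] raise_chosen_inventory[OF d]
      by (simp add: inv_unit_def axis_def)
  qed
  let ?N = "{j. a \<noteq> Some j \<and> (c $ j \<le> 0 \<or> x' $ p w $ j \<noteq> x $ p w $ j)}"
  have agree: "x' $ p w $ j = y $ p w $ j \<and> c' $ j = d $ j" if "j \<notin> ?N" for j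
  proof (cases "a = Some j")
    case True
    \<comment> \<open>A chosen node is feasible and so has positive capacity; hence \<open>d\<close>
      already carries \<open>c'\<close> there, and the chosen node can be left out of
      \<open>?N\<close>.\<close>
    then have "c $ j > 0" using policy_feasible by (simp add: a_def)
    with True show ?thesis by (simp add: y_chosen d_def)
  next
    case False
    with that show ?thesis by (auto simp: y_other d_def)
  qed
  have "\<pi> (y, d) w \<notin> Some ` ?N" by (auto simp: y)
  then have "\<pi> (x', c') w \<in> insert a (Some ` ?N)"
    using consistency_finite[OF finite _ agree] unfolding y by blast
  with new show ?thesis by (auto simp: a_def)
qed

section \<open>Processes compared with sequential simulation\<close>

abbreviation "seqs \<equiv> seq_state p \<pi> s1 \<omega>"
abbreviation "seqa \<equiv> seq_action p \<pi> s1 \<omega>"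
abbreviation "owned m \<equiv> assigned_times p \<omega> T (P m)"
abbreviation "ps m \<alpha> \<equiv> process_state p \<pi> s1 \<omega> (owned m) \<alpha>"
abbreviation "pa m \<alpha> t \<equiv> process_action p \<pi> \<omega> (owned m) \<alpha> (ps m \<alpha> t) t"
abbreviation "cache \<equiv> picard_cache p \<pi> s1 \<omega> T M P"

lemma seq_step: "\<forall>t\<ge>1. seqs (Suc t) = transition p (seqs t) (seqa t) (\<omega> t)"
  by (simp add: seq_action_def)

lemma process_step: "\<forall>t\<ge>1. ps m \<alpha> (Suc t) = transition p (ps m \<alpha> t) (pa m \<alpha> t) (\<omega> t)"
  by simp

lemmas seq_inventory = inventory_usage[OF seq_step]
lemmas seq_capacity = capacity_usage[OF seq_step]
lemmas seq_antimono = capacity_antimono[OF seq_step]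
lemmas process_inventory = inventory_usage[OF process_step]
lemmas process_capacity = capacity_usage[OF process_step]
lemmas process_antimono = capacity_antimono[OF process_step]

text \<open>The bound is per product because a process decides only on its own products and takes
  the others from the cache. Exhausted nodes are exempt, since \<open>policy_shift\<close> does not
  exclude a diversion to them.\<close>

definition dominated :: "(nat \<Rightarrow> 'j option) \<Rightarrow> nat \<Rightarrow> bool" where
  "dominated a t \<longleftrightarrow>
    (\<forall>i j. snd (seqs t) $ j > 0 \<longrightarrow> usage p \<omega> a i j t \<le> usage p \<omega> seqa i j t)"

lemma process_capacity_ge:
  assumes "dominated (pa m \<alpha>) t" "t \<ge> 1" "snd (seqs t) $ j > 0"
  shows "\<exists>n. snd (ps m \<alpha> t) $ j = snd (seqs t) $ j + real n"
proof
  have "(\<Sum>i\<in>UNIV. usage p \<omega> (pa m \<alpha>) i j t) \<le> (\<Sum>i\<in>UNIV. usage p \<omega> seqa i j t)"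
    using assms by (intro sum_mono) (auto simp: dominated_def)
  then show "snd (ps m \<alpha> t) $ j = snd (seqs t) $ j +
      real ((\<Sum>i\<in>UNIV. usage p \<omega> seqa i j t) - (\<Sum>i\<in>UNIV. usage p \<omega> (pa m \<alpha>) i j t))"
    using process_capacity[OF \<open>t \<ge> 1\<close>, of m \<alpha> j] seq_capacity[OF \<open>t \<ge> 1\<close>, of j]
    by (simp add: of_nat_diff)
qed

lemma process_inventory_ge:
  assumes "dominated (pa m \<alpha>) t" "t \<ge> 1" "snd (seqs t) $ j > 0"
  shows "\<exists>n. fst (ps m \<alpha> t) $ i $ j = fst (seqs t) $ i $ j + real n"
proof
  have "usage p \<omega> (pa m \<alpha>) i j t \<le> usage p \<omega> seqa i j t"
    using assms by (auto simp: dominated_def)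
  then show "fst (ps m \<alpha> t) $ i $ j = fst (seqs t) $ i $ j +
      real (usage p \<omega> seqa i j t - usage p \<omega> (pa m \<alpha>) i j t)"
    using process_inventory[OF \<open>t \<ge> 1\<close>, of m \<alpha> i j] seq_inventory[OF \<open>t \<ge> 1\<close>, of i j]
    by (simp add: of_nat_diff)
qed

text \<open>Domination supplies the natural-number surpluses that \<open>policy_shift\<close> asks
  for. It covers the stock at the sequentially chosen node because that node, being feasible, still
  has capacity.\<close>

lemma process_policy_shift:
  assumes dom: "dominated (pa m \<alpha>) t" and t: "t \<ge> 1"
    and new: "\<pi> (ps m \<alpha> t) (\<omega> t) \<noteq> seqa t"
  shows "\<exists>j. \<pi> (ps m \<alpha> t) (\<omega> t) = Some j \<and>
    (snd (seqs t) $ j \<le> 0 \<or> fst (ps m \<alpha> t) $ p (\<omega> t) $ j \<noteq> fst (seqs t) $ p (\<omega> t) $ j)"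
proof -
  obtain x c x' c' where s: "seqs t = (x, c)" "ps m \<alpha> t = (x', c')" by fastforce
  show ?thesis
    using policy_shift[of c c' x "\<omega> t" x'] process_capacity_ge[OF dom t]
      process_inventory_ge[OF dom t] policy_feasible[of x c "\<omega> t"] new
    by (auto simp: s seq_action_def)
qed

text \<open>Products of other processes inherit the bound from the cache, since an infeasible cached
  action becomes \<open>None\<close>, which uses nothing. For an own product the bound could break
  only by serving \<open>j\<close> while the usages are equal; then the stock at \<open>j\<close> is
  sequential and \<open>j\<close> has capacity, so the policy cannot have been diverted to
  \<open>j\<close>.\<close>

lemma process_dominated:
  assumes \<alpha>: "\<And>t. t \<in> {1..T} \<Longrightarrow> dominated \<alpha> t"
    and "1 \<le> t" "t \<le> T"
  shows "dominated (pa m \<alpha>) t"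
  using assms(2,3)
proof (induction t rule: dec_induct)
  case base
  then show ?case by (simp add: dominated_def)
next
  case (step t)
  then have IH: "dominated (pa m \<alpha>) t" by simp
  show ?case unfolding dominated_def
  proof (intro allI impI)
    fix i j assume pos': "snd (seqs (Suc t)) $ j > 0"
    then have pos: "snd (seqs t) $ j > 0"
      using seq_antimono[of t "Suc t" j] step.hyps by linarith
    show "usage p \<omega> (pa m \<alpha>) i j (Suc t) \<le> usage p \<omega> seqa i j (Suc t)"
    proof (cases "i \<in> P m")
      case False
      then have "usage p \<omega> (pa m \<alpha>) i j (Suc t) \<le> usage p \<omega> \<alpha> i j (Suc t)"
        by (intro usage_mono)
          (auto simp: process_action_def assigned_times_def split: if_splits)
      also have "\<dots> \<le> usage p \<omega> seqa i j (Suc t)"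
        using \<alpha>[of "Suc t"] step.prems pos' by (auto simp: dominated_def)
      finally show ?thesis .
    next
      case True
      have le: "usage p \<omega> (pa m \<alpha>) i j t \<le> usage p \<omega> seqa i j t"
        using IH pos by (simp add: dominated_def)
      have "seqa t = Some j"
        if eq: "usage p \<omega> (pa m \<alpha>) i j t = usage p \<omega> seqa i j t"
          and i: "p (\<omega> t) = i" and j: "pa m \<alpha> t = Some j"
      proof (rule ccontr)
        assume "seqa t \<noteq> Some j"
        moreover have "t \<in> owned m" using i True step by (simp add: assigned_times_def)
        then have "\<pi> (ps m \<alpha> t) (\<omega> t) = Some j" using j by (simp add: process_action_def)
        moreover have "fst (ps m \<alpha> t) $ i $ j = fst (seqs t) $ i $ j"
          using eq process_inventory[of t m \<alpha> i j] seq_inventory[of t i j] step.hyps by simp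
        ultimately show False
          using process_policy_shift[OF IH step.hyps(1)] i pos by force
      qed
      then show ?thesis using le step.hyps(1) by (fastforce simp: usage_Suc)
    qed
  qed
qed

lemma cache_Suc:
  assumes "m \<in> {1..M}" "t \<in> owned m"
  shows "cache (Suc k) t = pa m (cache k) t"
proof -
  have "(THE m. m \<in> {1..M} \<and> t \<in> owned m) = m"
  proof (rule the_equality)
    fix n assume "n \<in> {1..M} \<and> t \<in> owned n"
    then show "n = m"
      using assms disjoint_family_onD[OF disjoint, of n m] by (auto simp: assigned_times_def)
  qed (use assms in simp)
  then show ?thesis by (simp add: Let_def)
qed

lemma obtain_process:
  obtains m where "m \<in> {1..M}" "i \<in> P m"
  using cover by blast

text \<open>All orders for one product belong to the same process, so the counts of each product in
  the cache are those of a single process.\<close>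

lemma cache_dominated:
  assumes "t \<in> {1..T}"
  shows "dominated (cache k) t"
  using assms
proof (induction k arbitrary: t)
  case 0
  then show ?case by (simp add: dominated_def usage_def)
next
  case (Suc k)
  show ?case unfolding dominated_def
  proof (intro allI impI)
    fix i j assume pos: "snd (seqs t) $ j > 0"
    obtain m where m: "m \<in> {1..M}" "i \<in> P m" by (rule obtain_process)
    have "usage p \<omega> (cache (Suc k)) i j t = usage p \<omega> (pa m (cache k)) i j t"
    proof (rule usage_cong)
      fix s assume "s \<in> {1..<t}" "p (\<omega> s) = i"
      then have "s \<in> owned m" using m Suc.prems by (simp add: assigned_times_def)
      then show "cache (Suc k) s = pa m (cache k) s" by (rule cache_Suc[OF m(1)])
    qed
    also have "\<dots> \<le> usage p \<omega> seqa i j t"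
      using process_dominated[of "cache k" t m] Suc pos by (simp add: dominated_def)
    finally show "usage p \<omega> (cache (Suc k)) i j t \<le> usage p \<omega> seqa i j t" .
  qed
qed

section \<open>Correctness of the cache\<close>

lemma process_state_correct:
  assumes "t \<ge> 1"
    and "\<And>s. s \<in> {1..<t} \<Longrightarrow> \<alpha> s = seqa s"
  shows "ps m \<alpha> t = seqs t"
  using assms
proof (induction t rule: dec_induct)
  case (step t)
  then have eq: "ps m \<alpha> t = seqs t" and "\<alpha> t = seqa t" by auto
  \<comment> \<open>Feasibility ensures that a correct cached action is not replaced by
    \<open>None\<close>.\<close>
  moreover have "seqa t \<in> feasible p (\<omega> t) (seqs t)"
    using policy unfolding fulfillment_policy_def seq_action_def by (metis surj_pair)
  ultimately have "pa m \<alpha> t = seqa t" by (simp add: process_action_def seq_action_def)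
  then show ?case using eq seq_step process_step[of m \<alpha>] step.hyps by simp
qed simp

text \<open>Its cardinality, which never decreases over the time-steps, measures the progress of the
  iteration.\<close>

definition exhausted :: "nat \<Rightarrow> 'j set" where
  "exhausted t = {j. snd (seqs t) $ j \<le> 0}"

lemma exhausted_mono: "1 \<le> s \<Longrightarrow> s \<le> t \<Longrightarrow> exhausted s \<subseteq> exhausted t"
  using seq_antimono[of s t] by (force simp: exhausted_def intro: order_trans)

text \<open>Capacities never grow, so exhaustion at any time-step persists until \<open>T\<close>.
  For \<open>T = 0\<close> the two sides may differ: \<open>exhausted_nodes\<close> is then empty,
  while the dummy state at index 0 may have nodes without capacity.\<close>

lemma exhausted_nodes_eq:
  assumes "T \<ge> 1"
  shows "exhausted_nodes p \<pi> s1 \<omega> T T = exhausted T"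
proof -
  have "exhaustion_time p \<pi> s1 \<omega> T j \<le> T \<longleftrightarrow> (\<exists>t\<in>{1..T}. j \<in> exhausted t)" for j
  proof (cases "\<exists>t\<in>{1..T}. snd (seqs t) $ j \<le> 0")
    case True
    then have "Min {t \<in> {1..T}. snd (seqs t) $ j \<le> 0} \<in> {t \<in> {1..T}. snd (seqs t) $ j \<le> 0}"
      by (intro Min_in) auto
    with True show ?thesis by (auto simp: exhaustion_time_def exhausted_def)
  next
    case False
    then show ?thesis by (auto simp: exhaustion_time_def exhausted_def)
  qed
  moreover have "(\<exists>t\<in>{1..T}. j \<in> exhausted t) \<longleftrightarrow> j \<in> exhausted T" for j
    using exhausted_mono[of _ T] assms by fastforce
  ultimately show ?thesis by (auto simp: exhausted_nodes_def)
qed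

text \<open>Before the first exhaustion of \<open>j\<close> (time \<open>u\<close>) strictly fewer
  nodes are exhausted, so the cache is correct until then. The process thus reaches the sequential
  state at \<open>u\<close>, and capacity never recovers afterwards.\<close>

lemma process_exhausted:
  assumes t: "t \<ge> 1" and j: "j \<in> exhausted t"
    and \<alpha>: "\<And>s. 1 \<le> s \<Longrightarrow> s < t \<Longrightarrow> exhausted s \<subset> exhausted t \<Longrightarrow> \<alpha> s = seqa s"
  shows "snd (ps m \<alpha> t) $ j \<le> 0"
proof -
  define u where "u = (LEAST u. 1 \<le> u \<and> j \<in> exhausted u)"
  have u: "1 \<le> u" "j \<in> exhausted u" "u \<le> t"
    using LeastI[of "\<lambda>u. 1 \<le> u \<and> j \<in> exhausted u" t] t j
      Least_le[of "\<lambda>u. 1 \<le> u \<and> j \<in> exhausted u" t] by (auto simp: u_def)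
  have "\<alpha> s = seqa s" if s: "s \<in> {1..<u}" for s
  proof (rule \<alpha>)
    have "j \<notin> exhausted s" using s not_less_Least[of s] by (auto simp: u_def)
    then show "exhausted s \<subset> exhausted t" using exhausted_mono[of s t] s u j by auto
  qed (use s u in auto)
  then have "ps m \<alpha> u = seqs u" using u by (intro process_state_correct) auto
  then show ?thesis
    using process_antimono[of u t m \<alpha> j] u by (simp add: exhausted_def)
qed

text \<open>Both diversions left open by \<open>process_policy_shift\<close> are ruled out. Earlier
  orders for the same product have the same owner and are correct by induction, so its stock is
  sequential; sequentially exhausted nodes are exhausted for the process too, hence infeasible. The
  cache is trusted below level \<open>k\<close> and the result reaches level \<open>k\<close>, which
  is the gain of one iteration.\<close>

lemma process_action_correct:
  assumes dom: "\<And>t. t \<in> {1..T} \<Longrightarrow> dominated \<alpha> t"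
    and \<alpha>: "\<And>s. s \<in> {1..T} \<Longrightarrow> card (exhausted s) < k \<Longrightarrow> \<alpha> s = seqa s"
    and "t \<in> owned m" "card (exhausted t) \<le> k"
  shows "pa m \<alpha> t = seqa t"
  using assms(3,4)
proof (induction t rule: less_induct)
  case (less t)
  have t: "1 \<le> t" "t \<le> T" and i: "p (\<omega> t) \<in> P m"
    using less.prems by (auto simp: assigned_times_def)
  have "usage p \<omega> (pa m \<alpha>) (p (\<omega> t)) j t = usage p \<omega> seqa (p (\<omega> t)) j t" for j
  proof (rule usage_cong)
    fix s assume s: "s \<in> {1..<t}" "p (\<omega> s) = p (\<omega> t)"
    then have "s \<in> owned m" using t i by (simp add: assigned_times_def)
    moreover have "card (exhausted s) \<le> card (exhausted t)"
      using s exhausted_mono by (intro card_mono) auto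
    ultimately show "pa m \<alpha> s = seqa s" using less s by simp
  qed
  then have inv: "fst (ps m \<alpha> t) $ p (\<omega> t) $ j = fst (seqs t) $ p (\<omega> t) $ j" for j
    using process_inventory[of t m \<alpha> "p (\<omega> t)" j] seq_inventory[of t "p (\<omega> t)" j] t by simp
  have cap: "snd (ps m \<alpha> t) $ j \<le> 0" if "snd (seqs t) $ j \<le> 0" for j
  proof (rule process_exhausted)
    fix s assume "1 \<le> s" "s < t" "exhausted s \<subset> exhausted t"
    \<comment> \<open>Strictness brings the bound \<open>\<le> k\<close> at \<open>t\<close> down to
      \<open>< k\<close> at \<open>s\<close>, where the cache is known to be correct.\<close>
    moreover from this have "card (exhausted s) < card (exhausted t)"
      by (intro psubset_card_mono) auto
    ultimately show "\<alpha> s = seqa s" using \<alpha> t less.prems by auto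
  qed (use that t in \<open>auto simp: exhausted_def\<close>)
  have "\<pi> (ps m \<alpha> t) (\<omega> t) = seqa t"
  proof (rule ccontr)
    assume "\<pi> (ps m \<alpha> t) (\<omega> t) \<noteq> seqa t"
    then obtain j where "\<pi> (ps m \<alpha> t) (\<omega> t) = Some j" "snd (seqs t) $ j \<le> 0"
      using process_policy_shift[OF process_dominated[OF dom t] t(1)] inv by blast
    then show False
      using policy_feasible[of "fst (ps m \<alpha> t)" "snd (ps m \<alpha> t)" "\<omega> t" j] cap[of j] by simp
  qed
  then show ?case using less.prems by (simp add: process_action_def)
qed

text \<open>Each iteration gains one level of \<open>card (exhausted t)\<close>. The empty initial
  cache needs no correct entry, as no cardinality is below 0.\<close>

lemma cache_correct:
  assumes "t \<in> {1..T}" "card (exhausted t) < k"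
  shows "cache k t = seqa t"
  using assms
proof (induction k arbitrary: t)
  case (Suc k)
  obtain m where m: "m \<in> {1..M}" "p (\<omega> t) \<in> P m" by (rule obtain_process)
  then have tm: "t \<in> owned m" using Suc.prems by (simp add: assigned_times_def)
  have "pa m (cache k) t = seqa t"
    by (rule process_action_correct[of _ k]) (use cache_dominated Suc tm in auto)
  then show ?case using cache_Suc[OF m(1) tm] by simp
qed simp

end

theorem theorem3p2:
  fixes p :: "'w \<Rightarrow> 'i::finite"
    and \<pi> :: "('i, 'j::finite, 'w) fo_policy"
    and s1 :: "('i, 'j) fo_state"
    and \<omega> :: "nat \<Rightarrow> 'w"
    and T M :: nat
    and P :: "nat \<Rightarrow> 'i set"
  assumes "fulfillment_policy p \<pi>"
    and "inventory_independence p \<pi>"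
    and "consistency p \<pi>"
    and "monotonicity p \<pi>"
    and "disjoint_family_on P {1..M}"
    and "(\<Union>m\<in>{1..M}. P m) = UNIV"
  shows "\<forall>t\<in>{1..T}. \<forall>k \<ge> card (exhausted_nodes p \<pi> s1 \<omega> T T) + 1.
           picard_cache p \<pi> s1 \<omega> T M P k t = seq_action p \<pi> s1 \<omega> t"
proof (intro ballI allI impI)
  interpret picard_fo p \<pi> s1 \<omega> T M P by unfold_locales (fact assms)+
  fix t k
  assume t: "t \<in> {1..T}" and k: "card (exhausted_nodes p \<pi> s1 \<omega> T T) + 1 \<le> k"
  \<comment> \<open>No time-step has a level above that of \<open>T\<close>, so one iteration more
    than this level puts every \<open>t\<close> strictly below \<open>k\<close>.\<close>
  have "card (exhausted t) \<le> card (exhausted T)"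
    using t exhausted_mono by (intro card_mono) auto
  also have "\<dots> = card (exhausted_nodes p \<pi> s1 \<omega> T T)"
    using t by (simp add: exhausted_nodes_eq)
  finally show "picard_cache p \<pi> s1 \<omega> T M P k t = seq_action p \<pi> s1 \<omega> t"
    using t k by (intro cache_correct) auto
qed

end
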